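(* Let $X$ and $Y$ be Banach spaces, $U\subset X$ be an open set and $T:Y\to X$ be a bounded linear operator. Then $T$ has finite rank if and only if for every Banach space $Z$ and every finitely locally Lipschitz function $f:U\to Z$, $f\circ T$ is Fréchet differentiable at $y\in Y$ whenever $f$ is Gâteaux differentiable at $Ty\in U$.
   Context: The composition $f\circ T$ is defined on the open set $T^{-1}(U)$. A function $f:U\subset X\to Z$ is finitely locally Lipschitz if for every finite dimensional affine subspace $V$ of $X$ with $U\cap V\ne\emptyset$, the restriction $f|_{U\cap V}$ is locally Lipschitz, i.e. for every $u\in U\cap V$ there exist $r,L>0$ with $\|f(x)-f(y)\|\le L\|x-y\|$ for all $x,y\in U\cap V\cap B(u,r)$, where $B(u,r)$ is the open ball of center $u$ and radius $r$. (Such $f$ need not be continuous.) Gâteaux differentiability of $f$ at $x$ means that there is a bounded linear operator $d_Gf(x):X\to Z$ with $\lim_{t\to0}\frac{f(x+th)-f(x)}{t}=d_Gf(x)h$ for each $h\in X$. Fréchet differentiability means that this limit is uniform for $h$ in the unit ball.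
   Formalization: The formal theorem additionally assumes that T^{-1}(U) is nonempty; if it is empty (e.g. U empty and T the identity of an infinite-dimensional space), the differentiability condition is vacuous and the stated equivalence fails. *)

theory Defs
  imports "HOL-Analysis.Analysis"
begin

text \<open>
  A statement about every Banach space \<open>Z\<close>, occurring as one side of an equivalence, needs a
  quantifier over Banach spaces inside a formula, which the type class \<open>banach\<close> cannot provide.
  Such spaces are therefore given by an explicit carrier with explicit operations; the carrier may be
  any subset of a type \<open>'z\<close>, which plays the role of a universe. Scalars are real.
  A nonzero real vector space has at least as many elements as \<open>real\<close>, so a universe contains a nonzero
  Banach space exactly when \<open>real\<close> injects into it; over a smaller one the quantifier would be void.
\<close>

record 'z normed_structure =
  carr :: "'z set"
  add :: "'z \<Rightarrow> 'z \<Rightarrow> 'z"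
  zero :: 'z
  scale :: "real \<Rightarrow> 'z \<Rightarrow> 'z"
  nrm :: "'z \<Rightarrow> real"

definition sub :: "'z normed_structure \<Rightarrow> 'z \<Rightarrow> 'z \<Rightarrow> 'z"
  where "sub Z u v = add Z u (scale Z (- 1) v)"

locale normed_vector_space =
  fixes Z :: "'z normed_structure"
  assumes zero_closed: "zero Z \<in> carr Z"
    and add_closed: "\<lbrakk>u \<in> carr Z; v \<in> carr Z\<rbrakk> \<Longrightarrow> add Z u v \<in> carr Z"
    and scale_closed: "u \<in> carr Z \<Longrightarrow> scale Z a u \<in> carr Z"
    and add_assoc: "\<lbrakk>u \<in> carr Z; v \<in> carr Z; w \<in> carr Z\<rbrakk>
          \<Longrightarrow> add Z (add Z u v) w = add Z u (add Z v w)"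
    and add_commute: "\<lbrakk>u \<in> carr Z; v \<in> carr Z\<rbrakk> \<Longrightarrow> add Z u v = add Z v u"
    and add_zero: "u \<in> carr Z \<Longrightarrow> add Z u (zero Z) = u"
    and add_inverse: "u \<in> carr Z \<Longrightarrow> \<exists>v\<in>carr Z. add Z u v = zero Z"
    and scale_add_right: "\<lbrakk>u \<in> carr Z; v \<in> carr Z\<rbrakk>
          \<Longrightarrow> scale Z a (add Z u v) = add Z (scale Z a u) (scale Z a v)"
    and scale_add_left: "u \<in> carr Z
          \<Longrightarrow> scale Z (a + b) u = add Z (scale Z a u) (scale Z b u)"
    and scale_scale: "u \<in> carr Z \<Longrightarrow> scale Z a (scale Z b u) = scale Z (a * b) u"
    and scale_one: "u \<in> carr Z \<Longrightarrow> scale Z 1 u = u"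
    and nrm_nonneg: "u \<in> carr Z \<Longrightarrow> 0 \<le> nrm Z u"
    and nrm_eq_zero: "u \<in> carr Z \<Longrightarrow> nrm Z u = 0 \<longleftrightarrow> u = zero Z"
    and nrm_scale: "u \<in> carr Z \<Longrightarrow> nrm Z (scale Z a u) = \<bar>a\<bar> * nrm Z u"
    and nrm_triangle: "\<lbrakk>u \<in> carr Z; v \<in> carr Z\<rbrakk>
          \<Longrightarrow> nrm Z (add Z u v) \<le> nrm Z u + nrm Z v"

locale banach_space = normed_vector_space Z for Z :: "'z normed_structure" +
  assumes complete: "Metric_space.mcomplete (carr Z) (\<lambda>u v. nrm Z (sub Z u v))"

definition bounded_linear_into ::
    "'z normed_structure \<Rightarrow> ('a::real_normed_vector \<Rightarrow> 'z) \<Rightarrow> bool"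
  where "bounded_linear_into Z D \<longleftrightarrow>
    (\<forall>h. D h \<in> carr Z) \<and>
    (\<forall>h k. D (h + k) = add Z (D h) (D k)) \<and>
    (\<forall>a h. D (a *\<^sub>R h) = scale Z a (D h)) \<and>
    (\<exists>K. \<forall>h. nrm Z (D h) \<le> K * norm h)"

definition finite_dim_subspace :: "'a::real_vector set \<Rightarrow> bool"
  where "finite_dim_subspace W \<longleftrightarrow> subspace W \<and> (\<exists>B. finite B \<and> span B = W)"

definition finite_dim_affine :: "'a::real_vector set \<Rightarrow> bool"
  where "finite_dim_affine V \<longleftrightarrow> (\<exists>a W. finite_dim_subspace W \<and> V = (+) a ` W)"

definition finite_rank :: "('a \<Rightarrow> 'b::real_vector) \<Rightarrow> bool"
  where "finite_rank T \<longleftrightarrow> finite_dim_subspace (range T)"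

definition locally_lipschitz_on ::
    "'z normed_structure \<Rightarrow> 'a::real_normed_vector set \<Rightarrow> ('a \<Rightarrow> 'z) \<Rightarrow> bool"
  where "locally_lipschitz_on Z S f \<longleftrightarrow>
    (\<forall>u\<in>S. \<exists>r>0. \<exists>L>0. \<forall>x \<in> S \<inter> ball u r. \<forall>y \<in> S \<inter> ball u r.
       nrm Z (sub Z (f x) (f y)) \<le> L * norm (x - y))"

definition finitely_locally_lipschitz_on ::
    "'z normed_structure \<Rightarrow> 'a::real_normed_vector set \<Rightarrow> ('a \<Rightarrow> 'z) \<Rightarrow> bool"
  where "finitely_locally_lipschitz_on Z U f \<longleftrightarrow>
    (\<forall>V. finite_dim_affine V \<and> U \<inter> V \<noteq> {} \<longrightarrow> locally_lipschitz_on Z (U \<inter> V) f)"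

definition diff_quotient ::
    "'z normed_structure \<Rightarrow> ('a::real_normed_vector \<Rightarrow> 'z) \<Rightarrow> 'a \<Rightarrow> 'a \<Rightarrow> real \<Rightarrow> 'z"
  where "diff_quotient Z f x h t = scale Z (1 / t) (sub Z (f (x + t *\<^sub>R h)) (f x))"

text \<open>
  The two notions below are meant for \<open>f\<close> taking values in \<open>carr Z\<close> on a neighbourhood of \<open>x\<close>;
  they do not depend on the values of \<open>f\<close> outside such a neighbourhood.
\<close>

definition gateaux_differentiable ::
    "'z normed_structure \<Rightarrow> ('a::real_normed_vector \<Rightarrow> 'z) \<Rightarrow> 'a \<Rightarrow> bool"
  where "gateaux_differentiable Z f x \<longleftrightarrow>
    (\<exists>D. bounded_linear_into Z D \<and>
      (\<forall>h. ((\<lambda>t. nrm Z (sub Z (diff_quotient Z f x h t) (D h))) \<longlongrightarrow> 0) (at 0)))"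

definition frechet_differentiable ::
    "'z normed_structure \<Rightarrow> ('a::real_normed_vector \<Rightarrow> 'z) \<Rightarrow> 'a \<Rightarrow> bool"
  where "frechet_differentiable Z f x \<longleftrightarrow>
    (\<exists>D. bounded_linear_into Z D \<and>
      uniform_limit (cball 0 1)
        (\<lambda>t h. nrm Z (sub Z (diff_quotient Z f x h t) (D h))) (\<lambda>h. 0) (at 0))"

text \<open>The notions agree with those of the library when \<open>Z\<close> is a type of class \<open>banach\<close>.\<close>

definition type_space :: "'b::real_normed_vector normed_structure"
  where "type_space = \<lparr>carr = UNIV, add = (+), zero = 0, scale = (*\<^sub>R), nrm = norm\<rparr>"

lemma type_space_simps [simp]:
  "carr type_space = UNIV" "add type_space = (+)" "zero type_space = 0"
  "scale type_space = (*\<^sub>R)" "nrm type_space = norm" "sub type_space u v = u - v"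
  by (auto simp: type_space_def sub_def)

lemma banach_space_type_space: "banach_space (type_space :: 'b::banach normed_structure)"
proof
  have "(\<lambda>u v::'b. norm (u - v)) = dist"
    by (simp add: fun_eq_iff dist_norm)
  moreover have "Metric_space.mcomplete (UNIV::'b set) dist"
    by (simp add: complete_UNIV)
  ultimately show "Metric_space.mcomplete (carr (type_space :: 'b normed_structure))
      (\<lambda>u v. nrm type_space (sub type_space u v))"
    by simp
qed (auto simp: algebra_simps norm_triangle_ineq intro: exI [of _ "- _"])

lemma bounded_linear_into_type_space:
  "bounded_linear_into type_space D \<longleftrightarrow> bounded_linear D"
  unfolding bounded_linear_into_def bounded_linear_def bounded_linear_axioms_def linear_iff
  by (auto simp: mult.commute)

lemma gateaux_differentiable_type_space:
  "gateaux_differentiable type_space f x \<longleftrightarrow>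
    (\<exists>D. bounded_linear D \<and>
      (\<forall>h. ((\<lambda>t. (f (x + t *\<^sub>R h) - f x) /\<^sub>R t) \<longlongrightarrow> D h) (at 0)))"
  unfolding gateaux_differentiable_def bounded_linear_into_type_space
  by (simp add: diff_quotient_def tendsto_norm_zero_iff LIM_zero_iff divide_inverse)

lemma frechet_differentiable_type_space:
  "frechet_differentiable type_space f x \<longleftrightarrow> f differentiable (at x)"
proof -
  have "uniform_limit (cball 0 1)
          (\<lambda>t h. norm (diff_quotient type_space f x h t - D h)) (\<lambda>h. 0) (at 0)
        \<longleftrightarrow> (f has_derivative D) (at x)" (is "?U \<longleftrightarrow> ?F") if D: "bounded_linear D" for D
  proof -
    interpret D: bounded_linear D by fact
    have eq: "norm (diff_quotient type_space f x h t - D h)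
        = norm (f (x + t *\<^sub>R h) - f x - D (t *\<^sub>R h)) / \<bar>t\<bar>" if "t \<noteq> 0" for t h
    proof -
      have "diff_quotient type_space f x h t - D h
          = (1 / t) *\<^sub>R (f (x + t *\<^sub>R h) - f x - D (t *\<^sub>R h))"
        using that by (simp add: diff_quotient_def D.scaleR scaleR_diff_right)
      then show ?thesis by (simp add: divide_inverse mult.commute)
    qed
    have U: "?U \<longleftrightarrow> (\<forall>e>0. \<exists>d>0. \<forall>t. t \<noteq> 0 \<and> \<bar>t\<bar> < d \<longrightarrow>
        (\<forall>h\<in>cball 0 1. norm (f (x + t *\<^sub>R h) - f x - D (t *\<^sub>R h)) < e * \<bar>t\<bar>))"
      unfolding uniform_limit_iff eventually_at
      by (simp add: eq pos_divide_less_eq cong: conj_cong)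
    have F: "?F \<longleftrightarrow> (\<forall>e>0. \<exists>d>0. \<forall>k. norm k < d \<longrightarrow>
        norm (f (x + k) - f x - D k) \<le> e * norm k)"
      unfolding has_derivative_at_alt using D
      by (simp, metis add_diff_cancel_left' add.commute diff_add_cancel)
    show ?thesis
    proof
      assume u: ?U
      show ?F unfolding F
      proof (intro allI impI)
        fix e :: real assume "e > 0"
        then obtain d where d: "d > 0" and
          *: "\<And>t h. t \<noteq> 0 \<Longrightarrow> \<bar>t\<bar> < d \<Longrightarrow> norm h \<le> 1 \<Longrightarrow>
             norm (f (x + t *\<^sub>R h) - f x - D (t *\<^sub>R h)) < e * \<bar>t\<bar>"
          using u unfolding U by (auto simp: dist_norm)
        have "norm (f (x + k) - f x - D k) \<le> e * norm k" if "norm k < d" for k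
        proof (cases "k = 0")
          case False
          then show ?thesis using *[of "norm k" "k /\<^sub>R norm k"] that by simp
        qed (simp add: D.zero)
        with d show "\<exists>d>0. \<forall>k. norm k < d \<longrightarrow> norm (f (x + k) - f x - D k) \<le> e * norm k"
          by blast
      qed
    next
      assume f: ?F
      show ?U unfolding U
      proof (intro allI impI)
        fix e :: real assume e: "e > 0"
        then obtain d where d: "d > 0" and
          *: "\<And>k. norm k < d \<Longrightarrow> norm (f (x + k) - f x - D k) \<le> e / 2 * norm k"
          using f unfolding F by (meson half_gt_zero)
        have "norm (f (x + t *\<^sub>R h) - f x - D (t *\<^sub>R h)) < e * \<bar>t\<bar>"
          if t: "t \<noteq> 0" "\<bar>t\<bar> < d" and h: "norm h \<le> 1" for t h
        proof -
          have le: "norm (t *\<^sub>R h) \<le> \<bar>t\<bar>"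
            using h by (simp add: mult_left_le)
          then have "norm (f (x + t *\<^sub>R h) - f x - D (t *\<^sub>R h)) \<le> e / 2 * norm (t *\<^sub>R h)"
            using t by (intro *) linarith
          also have "\<dots> \<le> e / 2 * \<bar>t\<bar>"
            using le e by (intro mult_left_mono) auto
          also have "\<dots> < e * \<bar>t\<bar>" using e t by simp
          finally show ?thesis .
        qed
        with d show "\<exists>d>0. \<forall>t. t \<noteq> 0 \<and> \<bar>t\<bar> < d \<longrightarrow>
            (\<forall>h\<in>cball 0 1. norm (f (x + t *\<^sub>R h) - f x - D (t *\<^sub>R h)) < e * \<bar>t\<bar>)"
          by (auto simp: dist_norm)
      qed
    qed
  qed
  then show ?thesis
    unfolding frechet_differentiable_def bounded_linear_into_type_space differentiable_def
    by (auto intro: has_derivative_bounded_linear)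
qed

end

theory Submission
  imports Defs
begin

text \<open>
  If \<open>T\<close> has finite rank, the image of the unit ball under \<open>T\<close> is relatively compact, and on
  \<open>T y + range T\<close> the difference quotients of \<open>f\<close> are equi-Lipschitz in the direction; hence their
  pointwise convergence is uniform on that image. If \<open>T\<close> has infinite rank, some linear functional
  \<open>\<phi>\<close> on \<open>X\<close> makes \<open>\<phi> \<circ> T\<close> unbounded on the unit ball. It is bounded on every finite dimensional
  subspace, so \<open>x \<mapsto> \<phi> (x - T y)\<^sup>2\<close> is finitely locally Lipschitz, and its Gateaux derivative at
  \<open>T y\<close> is \<open>0\<close>; but the difference quotients \<open>t * \<phi> (T h)\<^sup>2\<close> of its composition with \<open>T\<close> are unbounded
  for \<open>h\<close> in the unit ball.
\<close>

section \<open>Finite dimensional subspaces\<close>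

text \<open>The point \<open>b\<close> has positive distance from the closed set \<open>W\<close>,
  and dividing \<open>w + a *\<^sub>R b\<close> by \<open>a\<close> gives \<open>b\<close> minus a
  point of \<open>W\<close>. The resulting control of the coordinate along \<open>b\<close> drives
  both inductions on a spanning set below.\<close>

lemma coordinate_bounded:
  fixes W :: "'a::real_normed_vector set"
  assumes W: "subspace W" "closed W" and b: "b \<notin> W"
  obtains \<delta> where "\<delta> > 0" "\<And>w a. w \<in> W \<Longrightarrow> \<bar>a\<bar> * \<delta> \<le> norm (w + a *\<^sub>R b)"
proof -
  obtain \<delta> where \<delta>: "\<delta> > 0" "ball b \<delta> \<subseteq> - W"
    using W(2) b by (metis ComplI open_Compl open_contains_ball)
  have "\<bar>a\<bar> * \<delta> \<le> norm (w + a *\<^sub>R b)" if w: "w \<in> W" for w a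
  proof (cases "a = 0")
    case False
    have "- (1 / a) *\<^sub>R w \<in> W"
      using W(1) w by (simp only: subspace_scale)
    then have "\<delta> \<le> norm (b - (- (1 / a) *\<^sub>R w))"
      using \<delta>(2) by (force simp: dist_norm not_le)
    also have "b - (- (1 / a) *\<^sub>R w) = (1 / a) *\<^sub>R (w + a *\<^sub>R b)"
      using False by (simp add: algebra_simps)
    finally have "\<delta> \<le> norm (w + a *\<^sub>R b) / \<bar>a\<bar>"
      by (simp add: divide_inverse mult.commute)
    then show ?thesis
      using False by (simp add: pos_le_divide_eq mult.commute)
  qed simp
  with \<delta>(1) show ?thesis by (rule that)
qed

text \<open>A convergent sequence is bounded, so it stays in a single compact slice. This turns
  compactness for a smaller span into the closedness that \<open>coordinate_bounded\<close> asks
  for.\<close>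

lemma closed_if_compact_balls:
  fixes W :: "'a::real_normed_vector set"
  assumes "\<And>r. compact (W \<inter> cball 0 r)"
  shows "closed W"
  unfolding closed_sequential_limits
proof (intro allI impI, elim conjE)
  fix x l assume x: "\<forall>n. x n \<in> W" and l: "x \<longlonglongrightarrow> l"
  then obtain r where r: "\<And>n. norm (x n) \<le> r"
    using convergent_imp_Bseq[of x] by (auto simp: convergent_def Bseq_def)
  have "closed (W \<inter> cball 0 r)"
    by (rule compact_imp_closed) fact
  moreover have "\<forall>n. x n \<in> W \<inter> cball 0 r"
    using x r by simp
  ultimately have "l \<in> W \<inter> cball 0 r"
    using l unfolding closed_sequential_limits by blast
  then show "l \<in> W" by simp
qed

text \<open>Induction on \<open>B\<close>: if \<open>b\<close> is new, both coordinates
  \<open>w\<close> and \<open>a\<close> of a point of the ball are bounded, so the slice lies in a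
  continuous image of a compact product. The radius stays arbitrary because the ball for
  \<open>w\<close> is larger than the one for the point.\<close>

lemma compact_span_cball:
  fixes B :: "'a::real_normed_vector set"
  assumes "finite B"
  shows "compact (span B \<inter> cball 0 r)"
  using assms
proof (induction B arbitrary: r)
  case empty
  have "{0::'a} \<inter> cball 0 r = {} \<or> {0::'a} \<inter> cball 0 r = {0}" by blast
  then show ?case by auto
next
  case (insert b B)
  show ?case
  proof (cases "b \<in> span B")
    case True
    then show ?thesis using insert.IH by (simp only: span_redundant)
  next
    case False
    obtain \<delta> where \<delta>: "\<delta> > 0"
      "\<And>w a. w \<in> span B \<Longrightarrow> \<bar>a\<bar> * \<delta> \<le> norm (w + a *\<^sub>R b)"
      using coordinate_bounded[OF subspace_span closed_if_compact_balls[OF insert.IH] False]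
      by blast
    \<comment> \<open>For \<open>x\<close> of norm at most \<open>r\<close>, the coordinate bound
      gives \<bar>a\<bar> \<le> \<open>r / \<delta>\<close>, and the triangle inequality then bounds
      the norm of \<open>x - a *\<^sub>R b\<close> by the radius used here.\<close>
    define K where "K = (\<lambda>(w, a). w + a *\<^sub>R b) `
      ((span B \<inter> cball 0 (r + r / \<delta> * norm b)) \<times> {- (r / \<delta>) .. r / \<delta>})"
    have "compact K"
      unfolding K_def case_prod_unfold
      by (intro compact_continuous_image compact_Times insert.IH continuous_intros) auto
    then have "compact (K \<inter> cball 0 r)"
      by (simp add: compact_Int_closed)
    also have "K \<inter> cball 0 r = span (insert b B) \<inter> cball 0 r"
    proof (intro equalityI subsetI)
      fix x assume x: "x \<in> K \<inter> cball 0 r"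
      then obtain w a where "w \<in> span B" "x = w + a *\<^sub>R b"
        unfolding K_def by auto
      then have "x - a *\<^sub>R b \<in> span B" by simp
      then show "x \<in> span (insert b B) \<inter> cball 0 r"
        using x span_breakdown_eq by blast
    next
      fix x assume x: "x \<in> span (insert b B) \<inter> cball 0 r"
      then obtain a where a: "x - a *\<^sub>R b \<in> span B"
        using span_breakdown_eq by blast
      have "\<bar>a\<bar> * \<delta> \<le> r"
        using \<delta>(2)[OF a, of a] x by simp
      then have ar: "\<bar>a\<bar> \<le> r / \<delta>"
        using \<delta>(1) by (simp add: field_simps)
      have "norm (x - a *\<^sub>R b) \<le> norm x + \<bar>a\<bar> * norm b"
        using norm_triangle_ineq4[of x "a *\<^sub>R b"] by (simp only: norm_scaleR)
      also have "\<dots> \<le> r + r / \<delta> * norm b"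
        using x ar by (intro add_mono mult_right_mono) auto
      finally have "(x - a *\<^sub>R b, a) \<in>
          (span B \<inter> cball 0 (r + r / \<delta> * norm b)) \<times> {- (r / \<delta>) .. r / \<delta>}"
        using a ar by (auto simp: abs_le_iff)
      then have "x \<in> K"
        unfolding K_def by (rule rev_image_eqI) simp
      then show "x \<in> K \<inter> cball 0 r" using x by simp
    qed
    finally show ?thesis .
  qed
qed

text \<open>No continuity of \<phi> is assumed. In the induction, \<open>x\<close> splits as
  (\<open>x - a *\<^sub>R b\<close>) + \<open>a *\<^sub>R b\<close>; the first summand is handled by
  the old constant, the second by the bound on \<open>a\<close> in terms of
  \<open>norm x\<close>.\<close>

lemma linear_functional_bounded_on_span:
  fixes \<phi> :: "'a::real_normed_vector \<Rightarrow> real"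
  assumes "finite B" and \<phi>: "linear \<phi>"
  shows "\<exists>C\<ge>0. \<forall>x\<in>span B. \<bar>\<phi> x\<bar> \<le> C * norm x"
  using assms(1)
proof (induction B)
  case empty
  then show ?case using linear_0[OF \<phi>] by auto
next
  case (insert b B)
  then obtain C where C: "C \<ge> 0" "\<And>x. x \<in> span B \<Longrightarrow> \<bar>\<phi> x\<bar> \<le> C * norm x"
    by blast
  show ?case
  proof (cases "b \<in> span B")
    case True
    then show ?thesis using C unfolding span_redundant[OF True] by blast
  next
    case False
    obtain \<delta> where \<delta>: "\<delta> > 0"
      "\<And>w a. w \<in> span B \<Longrightarrow> \<bar>a\<bar> * \<delta> \<le> norm (w + a *\<^sub>R b)"
      using coordinate_bounded[OF subspace_span
          closed_if_compact_balls[OF compact_span_cball[OF insert.hyps(1)]] False]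
      by blast
    define C' where "C' = C + (C * norm b + \<bar>\<phi> b\<bar>) / \<delta>"
    have "\<bar>\<phi> x\<bar> \<le> C' * norm x" if x: "x \<in> span (insert b B)" for x
    proof -
      obtain a where a: "x - a *\<^sub>R b \<in> span B"
        using x unfolding span_breakdown_eq by blast
      have a': "\<bar>a\<bar> \<le> norm x / \<delta>"
        using \<delta>(2)[OF a, of a] \<delta>(1) by (simp add: field_simps)
      have "\<phi> x = \<phi> (x - a *\<^sub>R b) + a * \<phi> b"
        by (simp add: linear_diff[OF \<phi>] linear_scale[OF \<phi>])
      then have "\<bar>\<phi> x\<bar> \<le> \<bar>\<phi> (x - a *\<^sub>R b)\<bar> + \<bar>a\<bar> * \<bar>\<phi> b\<bar>"
        using abs_triangle_ineq[of "\<phi> (x - a *\<^sub>R b)" "a * \<phi> b"] by (simp only: abs_mult)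
      also have "\<dots> \<le> C * (norm x + \<bar>a\<bar> * norm b) + \<bar>a\<bar> * \<bar>\<phi> b\<bar>"
        using C(2)[OF a] mult_left_mono[OF norm_triangle_ineq4[of x "a *\<^sub>R b"] C(1)]
        unfolding norm_scaleR by linarith
      also have "\<dots> = C * norm x + \<bar>a\<bar> * (C * norm b + \<bar>\<phi> b\<bar>)"
        by (simp add: algebra_simps)
      also have "\<dots> \<le> C * norm x + norm x / \<delta> * (C * norm b + \<bar>\<phi> b\<bar>)"
        using a' C(1) by (intro add_left_mono mult_right_mono) auto
      also have "\<dots> = C' * norm x"
        by (simp add: C'_def distrib_left add_divide_distrib mult_ac)
      finally show ?thesis .
    qed
    moreover have "C' \<ge> 0"
      using C(1) \<delta>(1) by (simp add: C'_def)
    ultimately show ?thesis by blast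
  qed
qed

text \<open>The values of a linear functional on a Hamel basis of \<open>range T\<close> are free.
  Prescribing \<open>real n * norm (y n)\<close> at the basis vector \<open>T (y n)\<close> makes
  the normalized vector \<open>y n /\<^sub>R norm (y n)\<close> yield the value
  \<open>n\<close>.\<close>

lemma unbounded_functional_of_infinite_rank:
  fixes T :: "'y::real_normed_vector \<Rightarrow> 'x::real_vector"
  assumes T: "linear T" and inf: "\<not> finite_rank T"
  obtains \<phi> :: "'x \<Rightarrow> real" where "linear \<phi>" "\<And>C. \<exists>h\<in>cball 0 1. C < \<bar>\<phi> (T h)\<bar>"
proof -
  have sub: "subspace (range T)"
    using T linear_subspace_image subspace_UNIV by blast
  obtain B where B: "B \<subseteq> range T" "independent B" "range T \<subseteq> span B"
    using maximal_independent_subset by blast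
  then have "span B = range T"
    using sub span_minimal by blast
  then have "infinite B"
    using inf sub unfolding finite_rank_def finite_dim_subspace_def by blast
  then obtain b :: "nat \<Rightarrow> 'x" where b: "inj b" "range b \<subseteq> B"
    using infinite_countable_subset by blast
  then have "\<forall>n. \<exists>y. b n = T y" using B(1) by blast
  then obtain y where y: "\<And>n. b n = T (y n)" by metis
  \<comment> \<open>At basis vectors other than the \<open>b n\<close>, \<open>inv b\<close> returns
    an unspecified index; independence of \<open>B\<close> permits any values there.\<close>
  obtain \<phi> :: "'x \<Rightarrow> real" where \<phi>: "linear \<phi>"
    "\<And>x. x \<in> B \<Longrightarrow> \<phi> x = real (inv b x) * norm (y (inv b x))"
    using linear_independent_extend[OF B(2), of "\<lambda>x. real (inv b x) * norm (y (inv b x))"] by blast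
  have "\<exists>h\<in>cball 0 1. C < \<bar>\<phi> (T h)\<bar>" for C
  proof -
    obtain n where n: "C < real n" using reals_Archimedean2 by blast
    have "b n \<in> B" using b(2) by blast
    then have "b n \<noteq> 0" using B(2) dependent_zero by metis
    then have "y n \<noteq> 0" using y[of n] linear_0[OF T] by metis
    moreover have "\<phi> (T (y n)) = real n * norm (y n)"
      using \<phi>(2)[OF \<open>b n \<in> B\<close>] unfolding inv_f_f[OF b(1)] by (simp only: y[of n])
    ultimately have "\<phi> (T (y n /\<^sub>R norm (y n))) = real n"
      by (simp add: linear_scale[OF T] linear_scale[OF \<phi>(1)])
    with n \<open>y n \<noteq> 0\<close> show ?thesis
      by (intro bexI[of _ "y n /\<^sub>R norm (y n)"]) auto
  qed
  with \<phi>(1) show ?thesis by (rule that)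
qed

section \<open>Normed spaces with explicit carrier\<close>

context normed_vector_space
begin

lemma scale_zero_left: "u \<in> carr Z \<Longrightarrow> scale Z 0 u = zero Z"
  using nrm_eq_zero[OF scale_closed, of u 0] by (simp add: nrm_scale)

lemma sub_closed: "u \<in> carr Z \<Longrightarrow> v \<in> carr Z \<Longrightarrow> sub Z u v \<in> carr Z"
  by (simp add: sub_def add_closed scale_closed)

text \<open>The axioms only assert that some inverse exists; this identifies it with the scalar
  multiple by -1 on which \<open>sub\<close> is built.\<close>

lemma add_minus: "u \<in> carr Z \<Longrightarrow> add Z u (scale Z (- 1) u) = zero Z"
  using scale_add_left[of u 1 "- 1"] by (simp add: scale_one scale_zero_left)

lemma sub_eq_add_sub:
  assumes "u \<in> carr Z" "v \<in> carr Z" "w \<in> carr Z"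
  shows "sub Z u w = add Z (sub Z u v) (sub Z v w)"
proof -
  let ?v = "scale Z (- 1) v" and ?w = "scale Z (- 1) w"
  note c = assms scale_closed add_closed
  have "add Z (sub Z u v) (sub Z v w) = add Z u (add Z ?v (add Z v ?w))"
    by (simp add: sub_def add_assoc c)
  also have "add Z ?v (add Z v ?w) = add Z (add Z v ?v) ?w"
    by (simp add: add_assoc[symmetric] add_commute[of ?v v] c)
  also have "\<dots> = ?w"
    using add_zero[of ?w] add_commute[of ?w "zero Z"] by (simp add: add_minus zero_closed c)
  finally show ?thesis by (simp add: sub_def)
qed

lemma nrm_sub_triangle:
  assumes "u \<in> carr Z" "v \<in> carr Z" "w \<in> carr Z"
  shows "nrm Z (sub Z u w) \<le> nrm Z (sub Z u v) + nrm Z (sub Z v w)"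
  using nrm_triangle[of "sub Z u v" "sub Z v w"] sub_eq_add_sub[OF assms] assms
  by (simp add: sub_closed)

lemma scale_sub:
  assumes "u \<in> carr Z" "v \<in> carr Z"
  shows "scale Z a (sub Z u v) = sub Z (scale Z a u) (scale Z a v)"
  using assms by (simp add: sub_def scale_add_right scale_scale scale_closed)

lemma sub_sub_sub:
  assumes "u \<in> carr Z" "v \<in> carr Z" "w \<in> carr Z"
  shows "sub Z (sub Z u w) (sub Z v w) = sub Z u v"
proof -
  have "scale Z (- 1) (sub Z v w) = sub Z w v"
    using assms add_commute[of "scale Z (- 1) v" w]
    by (simp add: sub_def scale_add_right scale_scale scale_closed scale_one)
  then show ?thesis
    using sub_eq_add_sub[of u w v] assms by (simp add: sub_def)
qed

lemma diff_quotient_closed: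
  "f (x + t *\<^sub>R h) \<in> carr Z \<Longrightarrow> f x \<in> carr Z \<Longrightarrow> diff_quotient Z f x h t \<in> carr Z"
  by (simp add: diff_quotient_def sub_closed scale_closed)

text \<open>The base value \<open>f x\<close> cancels. Since the two arguments of \<open>f\<close>
  differ by \<open>t\<close> times \<open>h - k\<close>, a Lipschitz bound for \<open>f\<close>
  becomes a Lipschitz bound in the direction whose constant does not depend on
  \<open>t\<close>.\<close>

lemma nrm_sub_diff_quotient:
  assumes "f (x + t *\<^sub>R h) \<in> carr Z" "f (x + t *\<^sub>R k) \<in> carr Z" "f x \<in> carr Z"
  shows "nrm Z (sub Z (diff_quotient Z f x h t) (diff_quotient Z f x k t))
    = \<bar>1 / t\<bar> * nrm Z (sub Z (f (x + t *\<^sub>R h)) (f (x + t *\<^sub>R k)))"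
proof -
  have "sub Z (diff_quotient Z f x h t) (diff_quotient Z f x k t)
      = scale Z (1 / t) (sub Z (f (x + t *\<^sub>R h)) (f (x + t *\<^sub>R k)))"
    unfolding diff_quotient_def using assms
    by (simp only: scale_sub[symmetric] sub_closed sub_sub_sub)
  then show ?thesis
    using assms by (simp only: nrm_scale sub_closed)
qed

end

lemma bounded_linear_intoD_diff:
  assumes "bounded_linear_into Z D"
  shows "sub Z (D h) (D k) = D (h - k)"
proof -
  have "D (h + (- 1) *\<^sub>R k) = add Z (D h) (scale Z (- 1) (D k))"
    using assms unfolding bounded_linear_into_def by metis
  then show ?thesis by (simp add: sub_def)
qed

lemma bounded_linear_into_nonneg_bound:
  assumes "bounded_linear_into Z D"
  obtains K where "K \<ge> 0" "\<And>h. nrm Z (D h) \<le> K * norm h"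
proof -
  obtain K where K: "\<And>h. nrm Z (D h) \<le> K * norm h"
    using assms unfolding bounded_linear_into_def by blast
  have "nrm Z (D h) \<le> \<bar>K\<bar> * norm h" for h
    using K[of h] by (smt (verit) mult_right_mono norm_ge_zero)
  then show ?thesis using that[of "\<bar>K\<bar>"] by simp
qed

lemma bounded_linear_into_compose:
  assumes D: "bounded_linear_into Z D" and T: "bounded_linear T"
  shows "bounded_linear_into Z (D \<circ> T)"
proof -
  obtain K where K: "K \<ge> 0" "\<And>h. nrm Z (D h) \<le> K * norm h"
    using bounded_linear_into_nonneg_bound[OF D] by blast
  obtain M where M: "\<And>h. norm (T h) \<le> norm h * M"
    using bounded_linear.bounded[OF T] by blast
  have "nrm Z (D (T h)) \<le> K * M * norm h" for h
    using K(2)[of "T h"] mult_left_mono[OF M[of h] K(1)] by (simp add: mult_ac)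
  then show ?thesis
    using D unfolding bounded_linear_into_def
    by (auto simp: linear_add[OF bounded_linear.linear[OF T]]
        linear_scale[OF bounded_linear.linear[OF T]])
qed

section \<open>Finite rank operators\<close>

text \<open>The derivative is \<open>D \<circ> T\<close>. Uniformity comes from a finite net in the
  compact set \<open>range T \<inter> cball 0 M\<close>, which contains the image of the unit ball:
  convergence at the net points is simultaneous, and the Lipschitz bounds on the quotients and on
  \<open>D\<close> carry it to all other directions.\<close>

lemma frechet_differentiable_finite_rank_compose:
  fixes T :: "'y::real_normed_vector \<Rightarrow> 'x::real_normed_vector"
  assumes Z: "normed_vector_space Z" and U: "open U" and T: "bounded_linear T"
    and rank: "finite_rank T"
    and f: "f \<in> U \<rightarrow> carr Z" "finitely_locally_lipschitz_on Z U f"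
    and y: "T y \<in> U" and G: "gateaux_differentiable Z f (T y)"
  shows "frechet_differentiable Z (f \<circ> T) y"
proof -
  interpret normed_vector_space Z by fact
  interpret T: bounded_linear T by fact
  obtain D where D: "bounded_linear_into Z D"
    and lim: "\<And>h. ((\<lambda>t. nrm Z (sub Z (diff_quotient Z f (T y) h t) (D h))) \<longlongrightarrow> 0) (at 0)"
    using G unfolding gateaux_differentiable_def by blast
  have Dc: "D h \<in> carr Z" for h
    using D unfolding bounded_linear_into_def by blast
  obtain K where K: "K \<ge> 0" "\<And>h. nrm Z (D h) \<le> K * norm h"
    using bounded_linear_into_nonneg_bound[OF D] by blast
  obtain M where M: "M > 0" "\<And>h. norm (T h) \<le> norm h * M"
    using T.pos_bounded by blast
  \<comment> \<open>Every point \<open>T (y + t *\<^sub>R h)\<close> lies in this affine subspace,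
    so the Lipschitz hypothesis is needed on it alone.\<close>
  define V where "V = (+) (T y) ` range T"
  have "finite_dim_affine V"
    using rank unfolding finite_dim_affine_def finite_rank_def V_def by blast
  moreover have Ty: "T y \<in> U \<inter> V"
    using y T.zero unfolding V_def by (force intro: rev_image_eqI[of "T 0"])
  ultimately have "locally_lipschitz_on Z (U \<inter> V) f"
    using f(2) unfolding finitely_locally_lipschitz_on_def by blast
  then obtain r L where r: "r > 0" and L: "L > 0" and
    lip: "\<And>u v. u \<in> U \<inter> V \<inter> ball (T y) r \<Longrightarrow> v \<in> U \<inter> V \<inter> ball (T y) r \<Longrightarrow>
       nrm Z (sub Z (f u) (f v)) \<le> L * norm (u - v)"
    using Ty unfolding locally_lipschitz_on_def by blast
  obtain s where s: "s > 0" "ball (T y) s \<subseteq> U"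
    using U y open_contains_ball by blast
  obtain B where "finite B" "span B = range T"
    using rank unfolding finite_rank_def finite_dim_subspace_def by blast
  then have cpt: "compact (range T \<inter> cball 0 M)"
    using compact_span_cball by metis
  have "uniform_limit (cball 0 1)
      (\<lambda>t h. nrm Z (sub Z (diff_quotient Z (f \<circ> T) y h t) ((D \<circ> T) h))) (\<lambda>h. 0) (at 0)"
    unfolding uniform_limit_iff
  proof (intro allI impI)
    fix \<epsilon> :: real assume \<epsilon>: "\<epsilon> > 0"
    \<comment> \<open>Passing from \<open>T h\<close> to a net point within \<eta> costs at most
      \<open>L * \<eta>\<close> for the quotient and \<open>K * \<eta>\<close> for the derivative,
      together half of \<epsilon>; the other half is left for convergence at the net point.\<close>
    define \<eta> where "\<eta> = \<epsilon> / (2 * (L + K))"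
    have \<eta>: "\<eta> > 0" "(L + K) * \<eta> = \<epsilon> / 2"
      using \<epsilon> L K(1) by (auto simp: \<eta>_def field_simps)
    obtain N where N: "finite N" "N \<subseteq> range T \<inter> cball 0 M"
      "range T \<inter> cball 0 M \<subseteq> (\<Union>x\<in>N. ball x \<eta>)"
      using compactE_image[OF cpt, of "range T \<inter> cball 0 M" "\<lambda>x. ball x \<eta>"] \<eta>(1)
      by (metis (no_types, lifting) UN_iff centre_in_ball open_ball subsetI)
    have "\<forall>x\<in>N. \<forall>\<^sub>F t in at 0. nrm Z (sub Z (diff_quotient Z f (T y) x t) (D x)) < \<epsilon> / 2"
      using \<epsilon> by (intro ballI order_tendstoD(2)[OF lim]) simp
    then have ev1: "\<forall>\<^sub>F t in at 0. \<forall>x\<in>N.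
        nrm Z (sub Z (diff_quotient Z f (T y) x t) (D x)) < \<epsilon> / 2"
      by (rule eventually_ball_finite[OF N(1)])
    have "((\<lambda>t::real. \<bar>t\<bar> * M) \<longlongrightarrow> \<bar>0\<bar> * M) (at 0)"
      by (intro tendsto_intros)
    \<comment> \<open>Radius \<open>r\<close> makes the Lipschitz estimate available, and radius
      \<open>s\<close> keeps the points inside \<open>U\<close>.\<close>
    then have ev2: "\<forall>\<^sub>F t::real in at 0. \<bar>t\<bar> * M < min r s"
      using r s(1) by (intro order_tendstoD(2)[where y = "\<bar>0\<bar> * M"]) auto
    show "\<forall>\<^sub>F t in at 0. \<forall>h\<in>cball 0 1.
        dist (nrm Z (sub Z (diff_quotient Z (f \<circ> T) y h t) ((D \<circ> T) h))) 0 < \<epsilon>"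
      using ev1 ev2 eventually_neq_at_within[of 0]
    proof eventually_elim
      case (elim t)
      have mem: "T y + t *\<^sub>R k \<in> U \<inter> V \<inter> ball (T y) r" if k: "k \<in> range T \<inter> cball 0 M" for k
      proof -
        have "norm (t *\<^sub>R k) \<le> \<bar>t\<bar> * M"
          using k by (simp add: mult_left_mono)
        then have "norm (t *\<^sub>R k) < min r s"
          using elim(2) by linarith
        moreover have "t *\<^sub>R k \<in> range T"
          using k by (metis IntD1 T.scaleR imageE rangeI)
        ultimately have "T y + t *\<^sub>R k \<in> V" "T y + t *\<^sub>R k \<in> ball (T y) r"
            "T y + t *\<^sub>R k \<in> ball (T y) s"
          by (auto simp: V_def dist_norm)
        then show ?thesis using s(2) by blast
      qed
      show ?case
      proof
        fix h :: 'y assume h: "h \<in> cball 0 1"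
        have Th: "T h \<in> range T \<inter> cball 0 M"
          using M(2)[of h] M(1) h by (simp add: mult_left_le_one_le order_trans)
        then obtain x where x: "x \<in> N" "norm (x - T h) < \<eta>"
          using subsetD[OF N(3) Th] by (auto simp: dist_norm)
        have x': "x \<in> range T \<inter> cball 0 M" using x(1) N(2) by blast
        have fc: "f (T y + t *\<^sub>R T h) \<in> carr Z" "f (T y + t *\<^sub>R x) \<in> carr Z" "f (T y) \<in> carr Z"
          using f(1) mem[OF Th] mem[OF x'] y by auto
        let ?q = "\<lambda>k. diff_quotient Z f (T y) k t"
        have qc: "?q (T h) \<in> carr Z" "?q x \<in> carr Z"
          using fc by (auto intro: diff_quotient_closed)
        have "nrm Z (sub Z (?q (T h)) (?q x))
            \<le> \<bar>1 / t\<bar> * (L * norm ((T y + t *\<^sub>R T h) - (T y + t *\<^sub>R x)))"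
          unfolding nrm_sub_diff_quotient[OF fc]
          by (intro mult_left_mono lip mem Th x') auto
        also have "(T y + t *\<^sub>R T h) - (T y + t *\<^sub>R x) = t *\<^sub>R (T h - x)"
          by (simp add: algebra_simps)
        also have "\<bar>1 / t\<bar> * (L * norm (t *\<^sub>R (T h - x))) = L * norm (x - T h)"
          using elim(3) by (simp add: norm_minus_commute)
        finally have 1: "nrm Z (sub Z (?q (T h)) (?q x)) \<le> L * norm (x - T h)" .
        have 2: "nrm Z (sub Z (?q x) (D x)) < \<epsilon> / 2"
          using elim(1) x(1) by blast
        have 3: "nrm Z (sub Z (D x) (D (T h))) \<le> K * norm (x - T h)"
          using K(2) by (simp add: bounded_linear_intoD_diff[OF D])
        have "nrm Z (sub Z (?q (T h)) (D (T h)))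
            \<le> nrm Z (sub Z (?q (T h)) (?q x)) + (nrm Z (sub Z (?q x) (D x))
              + nrm Z (sub Z (D x) (D (T h))))"
          using nrm_sub_triangle[OF qc Dc[of "T h"]] nrm_sub_triangle[OF qc(2) Dc[of x] Dc[of "T h"]]
          by linarith
        also have "\<dots> < (L + K) * norm (x - T h) + \<epsilon> / 2"
          using 1 2 3 by (simp add: algebra_simps)
        also have "\<dots> \<le> (L + K) * \<eta> + \<epsilon> / 2"
          using x(2) L K(1) by (intro add_right_mono mult_left_mono) auto
        also have "\<dots> = \<epsilon>" using \<eta>(2) by simp
        finally have "nrm Z (sub Z (?q (T h)) (D (T h))) < \<epsilon>" .
        moreover have "diff_quotient Z (f \<circ> T) y h t = ?q (T h)"
          by (simp add: diff_quotient_def T.add T.scaleR)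
        ultimately show
          "dist (nrm Z (sub Z (diff_quotient Z (f \<circ> T) y h t) ((D \<circ> T) h))) 0 < \<epsilon>"
          using nrm_nonneg[OF sub_closed[OF qc(1) Dc[of "T h"]]] by simp
      qed
    qed
  qed
  then show ?thesis
    unfolding frechet_differentiable_def using bounded_linear_into_compose[OF D T] by blast
qed

section \<open>Operators of infinite rank\<close>

text \<open>The counterexample is real valued, but its target space must live in the universe
  \<open>'z\<close>; hence the real line is transported along an injection \<open>e\<close>, which
  becomes a linear isometry onto its range.\<close>

definition real_copy :: "(real \<Rightarrow> 'z) \<Rightarrow> 'z normed_structure" where
  "real_copy e = \<lparr>carr = range e, add = (\<lambda>u v. e (inv e u + inv e v)), zero = e 0,
    scale = (\<lambda>a u. e (a * inv e u)), nrm = (\<lambda>u. \<bar>inv e u\<bar>)\<rparr>"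

lemma real_copy_simps [simp]:
  assumes "inj e"
  shows "carr (real_copy e) = range e"
    and "add (real_copy e) (e a) (e b) = e (a + b)"
    and "zero (real_copy e) = e 0"
    and "scale (real_copy e) c (e a) = e (c * a)"
    and "nrm (real_copy e) (e a) = \<bar>a\<bar>"
    and "sub (real_copy e) (e a) (e b) = e (a - b)"
  using assms by (simp_all add: real_copy_def sub_def)

lemma banach_space_real_copy:
  assumes e: "inj e"
  shows "banach_space (real_copy e)"
proof
  show "\<exists>v\<in>carr (real_copy e). add (real_copy e) u v = zero (real_copy e)"
    if u: "u \<in> carr (real_copy e)" for u
  proof -
    obtain a where "u = e a" using u unfolding real_copy_simps(1)[OF e] by blast
    then show ?thesis using e by (intro bexI[of _ "e (- a)"]) auto
  qed
  let ?d = "\<lambda>u v. nrm (real_copy e) (sub (real_copy e) u v)"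
  interpret M: Metric_space "carr (real_copy e)" ?d
    by standard (use e in \<open>auto simp: real_copy_def sub_def inj_eq[OF e]\<close>)
  show "M.mcomplete"
    unfolding M.mcomplete_def
  proof (intro allI impI)
    fix \<sigma> assume \<sigma>: "M.MCauchy \<sigma>"
    then have "range \<sigma> \<subseteq> range e"
      using e unfolding M.MCauchy_def by simp
    then have "\<forall>n. \<exists>a. \<sigma> n = e a" by blast
    then obtain a where a: "\<And>n. \<sigma> n = e (a n)" by metis
    have "Cauchy a"
      using \<sigma> e unfolding M.MCauchy_def Cauchy_def by (simp add: a dist_real_def)
    then obtain l where "a \<longlonglongrightarrow> l"
      using Cauchy_convergent convergent_def by blast
    then have "limitin M.mtopology \<sigma> (e l) sequentially"
      using e unfolding M.limitin_metric tendsto_iff by (simp add: a dist_real_def)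
    then show "\<exists>x. limitin M.mtopology \<sigma> x sequentially" by blast
  qed
qed (use e in \<open>auto simp: inj_eq[OF e] distrib_left distrib_right abs_mult mult.assoc\<close>)

text \<open>A difference of squares factors as \<phi>(x - y) times \<phi>(x - c) + \<phi>(y - c). On
  a finite dimensional affine subspace the first factor is at most a multiple of
  \<open>norm (x - y)\<close>, and the second is bounded near each point.\<close>

lemma finitely_locally_lipschitz_square_functional:
  fixes \<phi> :: "'x::real_normed_vector \<Rightarrow> real"
  assumes e: "inj e" and \<phi>: "linear \<phi>"
  shows "finitely_locally_lipschitz_on (real_copy e) U (\<lambda>x. e ((\<phi> (x - c))\<^sup>2))"
  unfolding finitely_locally_lipschitz_on_def
proof (intro allI impI, elim conjE)
  fix V :: "'x set" assume "finite_dim_affine V"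
  then obtain a B where B: "finite B" and V: "V = (+) a ` span B"
    unfolding finite_dim_affine_def finite_dim_subspace_def by blast
  have diff: "x - y \<in> span B" if "x \<in> V" "y \<in> V" for x y
    using that span_diff[of _ B] unfolding V by auto
  obtain C where C: "C \<ge> 0" "\<And>x. x \<in> span B \<Longrightarrow> \<bar>\<phi> x\<bar> \<le> C * norm x"
    using linear_functional_bounded_on_span[OF B \<phi>] by blast
  show "locally_lipschitz_on (real_copy e) (U \<inter> V) (\<lambda>x. e ((\<phi> (x - c))\<^sup>2))"
    unfolding locally_lipschitz_on_def
  proof
    fix u assume u: "u \<in> U \<inter> V"
    \<comment> \<open>The centre \<open>c\<close> may lie outside \<open>V\<close>, so
      \<open>x - c\<close> is split at \<open>u\<close>: only \<open>x - u\<close> is known to lie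
      in the span on which \<phi> is bounded.\<close>
    define A where "A = C + \<bar>\<phi> (u - c)\<bar>"
    have bd: "\<bar>\<phi> (x - c)\<bar> \<le> A" if x: "x \<in> V" "x \<in> ball u 1" for x
    proof -
      have "\<phi> (x - c) = \<phi> (x - u) + \<phi> (u - c)"
        by (simp add: linear_diff[OF \<phi>])
      moreover have "\<bar>\<phi> (x - u)\<bar> \<le> C * norm (x - u)"
        using x u by (intro C(2) diff) auto
      moreover have "C * norm (x - u) \<le> C"
        using x C(1) by (intro mult_left_le) (auto simp: dist_norm norm_minus_commute)
      ultimately show ?thesis unfolding A_def by linarith
    qed
    \<comment> \<open>The added 1 keeps the Lipschitz constant positive, as the definition demands,
      even when \<open>C\<close> or \<open>A\<close> vanishes.\<close>
    have "\<bar>(\<phi> (x - c))\<^sup>2 - (\<phi> (y - c))\<^sup>2\<bar> \<le> (C * (2 * A) + 1) * norm (x - y)"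
      if x: "x \<in> V" "x \<in> ball u 1" and y: "y \<in> V" "y \<in> ball u 1" for x y
    proof -
      have "(\<phi> (x - c))\<^sup>2 - (\<phi> (y - c))\<^sup>2 = \<phi> (x - y) * (\<phi> (x - c) + \<phi> (y - c))"
        by (simp add: linear_diff[OF \<phi>] power2_eq_square algebra_simps)
      then have "\<bar>(\<phi> (x - c))\<^sup>2 - (\<phi> (y - c))\<^sup>2\<bar> = \<bar>\<phi> (x - y)\<bar> * \<bar>\<phi> (x - c) + \<phi> (y - c)\<bar>"
        by (simp add: abs_mult)
      also have "\<dots> \<le> (C * norm (x - y)) * (2 * A)"
        using bd[OF x] bd[OF y] C(1) C(2)[OF diff[OF x(1) y(1)]]
        by (intro mult_mono) auto
      also have "\<dots> \<le> (C * (2 * A) + 1) * norm (x - y)"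
        by (simp add: algebra_simps)
      finally show ?thesis .
    qed
    moreover have "C * (2 * A) + 1 > 0"
      using C(1) by (simp add: A_def add_nonneg_pos)
    ultimately show "\<exists>r>0. \<exists>L>0. \<forall>x\<in>U \<inter> V \<inter> ball u r. \<forall>y\<in>U \<inter> V \<inter> ball u r.
        nrm (real_copy e) (sub (real_copy e) (e ((\<phi> (x - c))\<^sup>2)) (e ((\<phi> (y - c))\<^sup>2)))
          \<le> L * norm (x - y)"
      using e by (intro exI[of _ 1] conjI exI[of _ "C * (2 * A) + 1"]) auto
  qed
qed

text \<open>The quotient at \<open>c\<close> in direction \<open>h\<close> is
  \<open>t * (\<phi> h)\<^sup>2\<close>, which tends to 0 for each fixed \<open>h\<close> however
  large \<phi> is; so the zero operator is the derivative.\<close>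

lemma gateaux_differentiable_square_functional:
  fixes \<phi> :: "'x::real_normed_vector \<Rightarrow> real"
  assumes e: "inj e" and \<phi>: "linear \<phi>"
  shows "gateaux_differentiable (real_copy e) (\<lambda>x. e ((\<phi> (x - c))\<^sup>2)) c"
  unfolding gateaux_differentiable_def
proof (intro exI conjI allI)
  show "bounded_linear_into (real_copy e) (\<lambda>h::'x. e 0)"
    unfolding bounded_linear_into_def using e by (auto intro: exI[of _ 0])
  fix h :: 'x
  have "((\<lambda>t. \<bar>t * (\<phi> h)\<^sup>2\<bar>) \<longlongrightarrow> \<bar>0 * (\<phi> h)\<^sup>2\<bar>) (at 0)"
    by (intro tendsto_intros)
  moreover have "nrm (real_copy e) (sub (real_copy e)
      (diff_quotient (real_copy e) (\<lambda>x. e ((\<phi> (x - c))\<^sup>2)) c h t) (e 0)) = \<bar>t * (\<phi> h)\<^sup>2\<bar>" for t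
    using e by (simp add: diff_quotient_def linear_scale[OF \<phi>] linear_0[OF \<phi>] power2_eq_square abs_mult)
  ultimately show "((\<lambda>t. nrm (real_copy e) (sub (real_copy e)
      (diff_quotient (real_copy e) (\<lambda>x. e ((\<phi> (x - c))\<^sup>2)) c h t) (e 0))) \<longlongrightarrow> 0) (at 0)"
    by simp
qed

text \<open>A candidate derivative \<open>D\<close> need not be identified: it is bounded by some
  \<open>K\<close> on the unit ball, so uniform closeness at a single nonzero \<open>t\<close> would
  bound \<open>t * (\<phi> (T h))\<^sup>2\<close> there.\<close>

lemma not_frechet_differentiable_square_functional:
  fixes T :: "'y::real_normed_vector \<Rightarrow> 'x::real_normed_vector"
  assumes e: "inj e" and \<phi>: "linear \<phi>" and T: "linear T"
    and unb: "\<And>C. \<exists>h\<in>cball 0 1. C < \<bar>\<phi> (T h)\<bar>"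
  shows "\<not> frechet_differentiable (real_copy e) ((\<lambda>x. e ((\<phi> (x - T y))\<^sup>2)) \<circ> T) y"
proof
  let ?Z = "real_copy e" and ?g = "(\<lambda>x. e ((\<phi> (x - T y))\<^sup>2)) \<circ> T"
  assume "frechet_differentiable ?Z ?g y"
  then obtain D where D: "bounded_linear_into ?Z D" and lim: "uniform_limit (cball 0 1)
        (\<lambda>t h. nrm ?Z (sub ?Z (diff_quotient ?Z ?g y h t) (D h))) (\<lambda>h. 0) (at 0)"
    unfolding frechet_differentiable_def by blast
  obtain K where K: "K \<ge> 0" "\<And>h. nrm ?Z (D h) \<le> K * norm h"
    using bounded_linear_into_nonneg_bound[OF D] by blast
  have "\<forall>\<^sub>F t in at 0. t \<noteq> 0 \<and> (\<forall>h\<in>cball 0 1.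
      dist (nrm ?Z (sub ?Z (diff_quotient ?Z ?g y h t) (D h))) 0 < 1)"
    using uniform_limitD[OF lim, of 1] eventually_neq_at_within[of "0::real" "0::real" UNIV]
    by (auto elim: eventually_elim2)
  then obtain t :: real where t: "t \<noteq> 0" "\<And>h. h \<in> cball 0 1 \<Longrightarrow>
      dist (nrm ?Z (sub ?Z (diff_quotient ?Z ?g y h t) (D h))) 0 < 1"
    using eventually_happens'[OF trivial_limit_at] by blast
  have bd: "\<bar>t\<bar> * (\<phi> (T h))\<^sup>2 < 1 + K" if h: "h \<in> cball 0 1" for h
  proof -
    obtain d where d: "D h = e d"
      using D unfolding bounded_linear_into_def real_copy_simps(1)[OF e] by blast
    have q: "diff_quotient ?Z ?g y h t = e (t * (\<phi> (T h))\<^sup>2)"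
      using e by (simp add: diff_quotient_def linear_add[OF T] linear_scale[OF T]
          linear_scale[OF \<phi>] linear_0[OF \<phi>] power2_eq_square mult.left_commute)
    have "\<bar>d\<bar> \<le> K * norm h" using K(2)[of h] d e by simp
    also have "\<dots> \<le> K" using K(1) h by (simp add: mult_left_le)
    finally have "\<bar>d\<bar> \<le> K" .
    moreover have "\<bar>t * (\<phi> (T h))\<^sup>2 - d\<bar> < 1"
      using t(2)[OF h] e by (simp add: q d)
    ultimately have "\<bar>t * (\<phi> (T h))\<^sup>2\<bar> < 1 + K" by linarith
    then show ?thesis by (simp add: abs_mult)
  qed
  \<comment> \<open>The maximum with 1 ensures that squaring does not decrease \<bar>\<phi> (T
    h)\<bar>, so the second bound passes to the square.\<close>
  obtain h where h: "h \<in> cball 0 1" "max 1 ((1 + K) / \<bar>t\<bar>) < \<bar>\<phi> (T h)\<bar>"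
    using unb by blast
  have "(1 + K) / \<bar>t\<bar> < (\<phi> (T h))\<^sup>2"
    using h(2) mult_strict_mono'[of 1 "\<bar>\<phi> (T h)\<bar>" 1 "\<bar>\<phi> (T h)\<bar>"]
      mult_left_mono[of 1 "\<bar>\<phi> (T h)\<bar>" "\<bar>\<phi> (T h)\<bar>"]
    by (simp add: power2_eq_square)
  then show False
    using bd[OF h(1)] t(1) by (simp add: field_simps)
qed

theorem theorem5p3:
  fixes T :: "'y::banach \<Rightarrow> 'x::banach" and U :: "'x set"
  assumes "open U" and "bounded_linear T"
    and "T -` U \<noteq> {}"
    and "\<exists>e :: real \<Rightarrow> 'z. inj e"
  shows "finite_rank T \<longleftrightarrow>
    (\<forall>Z :: 'z normed_structure. banach_space Z \<longrightarrow>
      (\<forall>f \<in> U \<rightarrow> carr Z. finitely_locally_lipschitz_on Z U f \<longrightarrow>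
        (\<forall>y. T y \<in> U \<and> gateaux_differentiable Z f (T y) \<longrightarrow>
          frechet_differentiable Z (f \<circ> T) y)))"
    (is "_ \<longleftrightarrow> ?R")
proof
  assume "finite_rank T"
  then show ?R
    using assms(1,2) frechet_differentiable_finite_rank_compose banach_space.axioms(1) by blast
next
  assume R: ?R
  show "finite_rank T"
  proof (rule ccontr)
    assume inf: "\<not> finite_rank T"
    have T: "linear T" using assms(2) by (rule bounded_linear.linear)
    obtain \<phi> :: "'x \<Rightarrow> real" where \<phi>: "linear \<phi>" "\<And>C. \<exists>h\<in>cball 0 1. C < \<bar>\<phi> (T h)\<bar>"
      using unbounded_functional_of_infinite_rank[OF T inf] by blast
    obtain e :: "real \<Rightarrow> 'z" where e: "inj e" using assms(4) by blast
    \<comment> \<open>The right-hand side speaks only about points that \<open>T\<close> maps into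
      \<open>U\<close>; this one becomes the centre of the counterexample.\<close>
    obtain y where y: "T y \<in> U" using assms(3) by blast
    have "(\<lambda>x. e ((\<phi> (x - T y))\<^sup>2)) \<in> U \<rightarrow> carr (real_copy e)"
      using e by simp
    then have "frechet_differentiable (real_copy e) ((\<lambda>x. e ((\<phi> (x - T y))\<^sup>2)) \<circ> T) y"
      using R banach_space_real_copy[OF e] finitely_locally_lipschitz_square_functional[OF e \<phi>(1)]
        gateaux_differentiable_square_functional[OF e \<phi>(1)] y by blast
    with not_frechet_differentiable_square_functional[OF e \<phi>(1) T \<phi>(2)] show False by blast
  qed
qed

end
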